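(* Let $\mathbb{F}$ be an algebraically closed field of characteristic $0$, and let $A\in M_{n}(\mathbb{F})$ be such that $\mathrm{tr}(A)=0$. Then $A$ is the sum of two strictly $n$-zero matrices.
   Context: $M_n(\mathbb{F})$ is the algebra of $n\times n$ matrices over $\mathbb{F}$, and $\mathrm{tr}$ is the trace. A matrix $B\in M_n(\mathbb{F})$ is strictly $k$-zero if it is nilpotent with index of nilpotency exactly $k$, i.e. $k$ is the least positive integer with $B^k=0$. *)

theory Defs
  imports "HOL-Computational_Algebra.Polynomial" "Jordan_Normal_Form.Matrix"
begin

definition mat_trace :: "'a :: comm_monoid_add mat \<Rightarrow> 'a" where
  "mat_trace A = (\<Sum>i < dim_row A. A $$ (i, i))"

text \<open>The index of nilpotency is the least \<^emph>\<open>positive\<close> exponent, so the zero matrix has index 1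
  and no matrix is strictly 0-zero.\<close>

definition strictly_zero :: "nat \<Rightarrow> 'a :: semiring_1 mat \<Rightarrow> bool" where
  "strictly_zero k B \<longleftrightarrow>
     square_mat B \<and> k > 0 \<and> B ^\<^sub>m k = 0\<^sub>m (dim_row B) (dim_row B) \<and>
     (\<forall>j. 0 < j \<and> j < k \<longrightarrow> B ^\<^sub>m j \<noteq> 0\<^sub>m (dim_row B) (dim_row B))"

end

theory Submission
  imports Defs "Jordan_Normal_Form.Column_Operations"
begin

text \<open>
  A matrix whose support is contained in a strict linear order on the indices, and contains every
  pair of consecutive indices, is strictly \<open>n\<close>-zero. Conjugating by transvections, replace \<open>A\<close> by a
  similar matrix \<open>Z\<close> with zero diagonal. Conjugations that keep the diagonal zero and depend on a
  generic parameter never lose a nonzero entry, so we may assume that none of them enlarges the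
  support of \<open>Z\<close>. If \<open>Z\<close> then has no two nonzero entries in opposite positions, its support is a
  transitive relation, hence \<open>Z\<close> is strictly triangular for some ordering of the indices and
  splits along the entries next to the diagonal. Otherwise there is a set of at least two indices
  on which all off-diagonal entries are nonzero. It can be enlarged one index at a time until it
  contains all indices, and then \<open>Z\<close> is the sum of its upper and lower triangular parts.
\<close>

section \<open>Generic parameters, similarity invariants, and nilpotency along an ordering\<close>

text \<open>Finitely many nonzero polynomials have only finitely many roots, while a domain of
  characteristic 0 is infinite. This yields one parameter value that avoids cancellation in many
  matrix entries simultaneously.\<close>

lemma generic_nonroot:
  fixes S :: "'a :: {idom, ring_char_0} poly set"
  assumes "finite S"
  shows "\<exists>t. \<forall>p\<in>S - {0}. poly p t \<noteq> 0"
proof -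
  have "finite (\<Union>p\<in>S - {0}. {t. poly p t = 0})"
    using assms by (auto intro: poly_roots_finite)
  then obtain t where "t \<notin> (\<Union>p\<in>S - {0}. {t. poly p t = 0})"
    using ex_new_if_finite[OF infinite_UNIV_char_0] by blast
  then show ?thesis by auto
qed

lemma mat_trace_comm:
  fixes A B :: "'a :: comm_semiring_0 mat"
  assumes "A \<in> carrier_mat n m" "B \<in> carrier_mat m n"
  shows "mat_trace (A * B) = mat_trace (B * A)"
proof -
  have "mat_trace (A * B) = (\<Sum>i<n. \<Sum>k<m. A $$ (i, k) * B $$ (k, i))"
    using assms unfolding mat_trace_def
    by (auto simp: scalar_prod_def lessThan_atLeast0 intro!: sum.cong)
  also have "\<dots> = (\<Sum>k<m. \<Sum>i<n. B $$ (k, i) * A $$ (i, k))"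
    by (subst sum.swap) (simp add: mult.commute)
  also have "\<dots> = mat_trace (B * A)"
    using assms unfolding mat_trace_def
    by (auto simp: scalar_prod_def lessThan_atLeast0 intro!: sum.cong)
  finally show ?thesis .
qed

lemma mat_trace_similar:
  fixes A B :: "'a :: comm_ring_1 mat"
  assumes "similar_mat A B"
  shows "mat_trace A = mat_trace B"
proof -
  obtain n P Q where c: "A \<in> carrier_mat n n" "B \<in> carrier_mat n n" "P \<in> carrier_mat n n"
      "Q \<in> carrier_mat n n" and QP: "Q * P = 1\<^sub>m n" and A: "A = P * B * Q"
    using similar_matD[OF assms] by auto
  have "mat_trace A = mat_trace (Q * (P * B))"
    unfolding A by (rule mat_trace_comm) (use c in auto)
  also have "Q * (P * B) = Q * P * B" using c by simp
  also have "\<dots> = B" using c by (simp add: QP)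
  finally show ?thesis .
qed

lemma strictly_zero_similar:
  fixes A B :: "'a :: comm_ring_1 mat"
  assumes wit: "similar_mat_wit A B P Q" and B: "strictly_zero k B"
  shows "strictly_zero k A"
proof -
  define n where "n = dim_row A"
  note w = similar_mat_witD[OF n_def wit]
  have eq: "A ^\<^sub>m j = 0\<^sub>m n n \<longleftrightarrow> B ^\<^sub>m j = 0\<^sub>m n n" for j
  proof
    assume "B ^\<^sub>m j = 0\<^sub>m n n"
    then show "A ^\<^sub>m j = 0\<^sub>m n n" using similar_mat_wit_pow_id[OF wit, of j] w by simp
  next
    assume "A ^\<^sub>m j = 0\<^sub>m n n"
    then show "B ^\<^sub>m j = 0\<^sub>m n n"
      using similar_mat_wit_pow_id[OF similar_mat_wit_sym[OF wit], of j] w by simp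
  qed
  have "dim_row A = n" "dim_row B = n" "dim_col A = n" "dim_col B = n" using w by auto
  then show ?thesis using B unfolding strictly_zero_def by (simp add: eq)
qed

text \<open>Entries of \<open>B ^\<^sub>m k\<close> are sums over walks of length \<open>k\<close>,
  and every step raises \<open>pos\<close> by at least 1. A walk that rises by exactly
  \<open>k\<close> passes through consecutive positions, so it is unique and its product is nonzero.
  Since positions differ by at most \<open>n - 1\<close>, the index is exactly
  \<open>n\<close>.\<close>

lemma strictly_zero_ordered:
  fixes B :: "'a :: idom mat"
  assumes B: "B \<in> carrier_mat n n" and n: "n \<ge> 1"
    and pos: "bij_betw pos {..<n} {..<n}"
    and up: "\<And>i j. i < n \<Longrightarrow> j < n \<Longrightarrow> B $$ (i, j) \<noteq> 0 \<Longrightarrow> pos i < pos j"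
    and next_nz: "\<And>i j. i < n \<Longrightarrow> j < n \<Longrightarrow> pos j = Suc (pos i) \<Longrightarrow> B $$ (i, j) \<noteq> 0"
  shows "strictly_zero n B"
proof -
  have inj: "i = j" if "i < n" "j < n" "pos i = pos j" for i j
    using pos that by (auto simp: bij_betw_def inj_on_def)
  have lt: "pos i < n" if "i < n" for i using pos that by (auto simp: bij_betw_def)
  have ex: "\<exists>i<n. pos i = m" if "m < n" for m
  proof -
    have "m \<in> pos ` {..<n}" using pos that by (simp add: bij_betw_def)
    then show ?thesis by auto
  qed
  have step: "(B ^\<^sub>m Suc k) $$ (i, j) = (\<Sum>l<n. (B ^\<^sub>m k) $$ (i, l) * B $$ (l, j))"
    if "i < n" "j < n" for i j k
    using B that by (simp add: scalar_prod_def lessThan_atLeast0)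
  have far: "pos i + k \<le> pos j" if "i < n" "j < n" "(B ^\<^sub>m k) $$ (i, j) \<noteq> 0" for i j k
    using that
  proof (induction k arbitrary: j)
    case 0
    then show ?case using B by (auto split: if_splits)
  next
    case (Suc k)
    then obtain l where "l < n" "(B ^\<^sub>m k) $$ (i, l) * B $$ (l, j) \<noteq> 0"
      unfolding step[OF Suc.prems(1,2)] by (metis (no_types, lifting) lessThan_iff sum.neutral)
    then show ?case using Suc.IH[of l] up[of l j] Suc.prems by force
  qed
  have hit: "(B ^\<^sub>m k) $$ (i, j) \<noteq> 0" if "i < n" "j < n" "pos j = pos i + k" for i j k
    using that
  proof (induction k arbitrary: j)
    case 0
    then show ?case using B inj by auto
  next
    case (Suc k)
    obtain l where l: "l < n" "pos l = pos i + k"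
      using ex[of "pos i + k"] lt[of j] Suc.prems by auto
    have zero: "(B ^\<^sub>m k) $$ (i, m) * B $$ (m, j) = 0" if "m \<in> {..<n} - {l}" for m
    proof (rule ccontr)
      assume "(B ^\<^sub>m k) $$ (i, m) * B $$ (m, j) \<noteq> 0"
      then have "pos m = pos l"
        using far[of i m k] up[of m j] that Suc.prems l by auto
      then show False using inj that l by auto
    qed
    have "(B ^\<^sub>m Suc k) $$ (i, j) = (B ^\<^sub>m k) $$ (i, l) * B $$ (l, j)"
      using l unfolding step[OF Suc.prems(1,2)]
      by (subst sum.remove[of _ l]) (simp_all add: sum.neutral[of "{..<n} - {l}"] zero del: mult_eq_0_iff)
    then show ?case using Suc.IH[of l] next_nz[of l j] Suc.prems l by simp
  qed
  have "B ^\<^sub>m n = 0\<^sub>m n n"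
  proof (rule eq_matI)
    fix i j assume ij: "i < dim_row (0\<^sub>m n n)" "j < dim_col (0\<^sub>m n n)"
    then show "(B ^\<^sub>m n) $$ (i, j) = 0\<^sub>m n n $$ (i, j)"
      using far[of i j n] lt[of j] by fastforce
  qed (use B in auto)
  moreover have "B ^\<^sub>m k \<noteq> 0\<^sub>m n n" if k: "k < n" for k
  proof -
    obtain i j where ij: "i < n" "j < n" "pos i = 0" "pos j = k"
      using ex[of 0] ex[OF k] k by auto
    then have "(B ^\<^sub>m k) $$ (i, j) \<noteq> 0" using hit by simp
    then show ?thesis using ij by auto
  qed
  ultimately show ?thesis using B n unfolding strictly_zero_def by auto
qed

section \<open>Zero diagonal up to similarity\<close>

definition hollow :: "nat \<Rightarrow> 'a :: zero mat \<Rightarrow> bool" where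
  "hollow n Z \<longleftrightarrow> Z \<in> carrier_mat n n \<and> (\<forall>i<n. Z $$ (i, i) = 0)"

text \<open>Each round clears a nonzero diagonal entry at \<open>k\<close> and may alter only one
  other diagonal entry, at an \<open>l\<close> where it was already nonzero. Hence the number of
  nonzero diagonal entries drops.\<close>

lemma similar_hollow:
  fixes A :: "'a :: field_char_0 mat"
  assumes "A \<in> carrier_mat n n" "mat_trace A = 0"
  shows "\<exists>Z. similar_mat Z A \<and> hollow n Z"
  using assms
proof (induction "card {i. i < n \<and> A $$ (i, i) \<noteq> 0}" arbitrary: A rule: less_induct)
  case less
  let ?D = "\<lambda>A :: 'a mat. {i. i < n \<and> A $$ (i, i) \<noteq> 0}"
  have reduce: ?case if k: "k < n" "A $$ (k, k) \<noteq> 0" "l < n" "A $$ (l, l) \<noteq> 0" "k \<noteq> l"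
    and C: "similar_mat C A" "C \<in> carrier_mat n n" "C $$ (k, k) = 0"
      "\<And>i. i < n \<Longrightarrow> i \<noteq> k \<Longrightarrow> i \<noteq> l \<Longrightarrow> C $$ (i, i) = A $$ (i, i)" for k l C
  proof -
    have "i \<in> ?D A" if "i \<in> ?D C" for i
      using that k C(3) C(4)[of i] by (cases "i = k"; cases "i = l") auto
    moreover have "k \<in> ?D A" "k \<notin> ?D C" using k C(3) by simp_all
    ultimately have "?D C \<subset> ?D A" by blast
    then have "card (?D C) < card (?D A)" by (intro psubset_card_mono) auto
    moreover have "mat_trace C = 0" using mat_trace_similar[OF C(1)] less.prems by simp
    ultimately show ?thesis using less.hyps C similar_mat_trans by blast
  qed
  show ?case
  proof (cases "?D A = {}")
    case True
    then show ?thesis using less.prems similar_mat_refl unfolding hollow_def by blast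
  next
    case False
    then obtain k where k: "k < n" "A $$ (k, k) \<noteq> 0" by auto
    \<comment> \<open>If all nonzero diagonal entries were equal, the trace would be a positive
      integer multiple of one of them, hence nonzero in characteristic 0.\<close>
    have "\<exists>l<n. A $$ (l, l) \<noteq> 0 \<and> A $$ (l, l) \<noteq> A $$ (k, k)"
    proof (rule ccontr)
      assume none: "\<not> ?thesis"
      have "mat_trace A = (\<Sum>i\<in>?D A. A $$ (i, i))"
        using less.prems unfolding mat_trace_def by (intro sum.mono_neutral_right) auto
      also have "\<dots> = (\<Sum>i\<in>?D A. A $$ (k, k))" using none by (intro sum.cong) auto
      finally show False using less.prems k by auto
    qed
    then obtain l where l: "l < n" "A $$ (l, l) \<noteq> 0" "A $$ (l, l) \<noteq> A $$ (k, k)" by auto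
    then have kl: "k \<noteq> l" by auto
    have clear: "\<exists>C. similar_mat C M \<and> C \<in> carrier_mat n n \<and> C $$ (k, k) = 0 \<and>
        (\<forall>i<n. i \<noteq> k \<longrightarrow> i \<noteq> l \<longrightarrow> C $$ (i, i) = M $$ (i, i))"
      if M: "M \<in> carrier_mat n n" and lk: "M $$ (l, k) \<noteq> 0" for M :: "'a mat"
    proof -
      \<comment> \<open>\<open>add_col_sub_row a k l\<close> adds \<open>a\<close> times column
        \<open>k\<close> to column \<open>l\<close> and subtracts \<open>a\<close> times row
        \<open>l\<close> from row \<open>k\<close>. So the diagonal entry at \<open>k\<close> loses
        \<open>a * M $$ (l, k)\<close>, and the one at \<open>l\<close> gains it.\<close>
      let ?C = "add_col_sub_row (M $$ (k, k) / M $$ (l, k)) k l M"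
      have "?C $$ (k, k) = 0" "\<forall>i<n. i \<noteq> k \<longrightarrow> i \<noteq> l \<longrightarrow> ?C $$ (i, i) = M $$ (i, i)"
        using M lk k l kl by simp_all
      then show ?thesis using add_col_sub_row_similar[OF M k(1) l(1) kl] add_col_sub_row_carrier(3)[OF M] by blast
    qed
    consider "A $$ (l, k) \<noteq> 0" | "A $$ (l, k) = 0" "A $$ (k, l) \<noteq> 0"
      | "A $$ (l, k) = 0" "A $$ (k, l) = 0" by blast
    then have "\<exists>C. similar_mat C A \<and> C \<in> carrier_mat n n \<and> C $$ (k, k) = 0 \<and>
        (\<forall>i<n. i \<noteq> k \<longrightarrow> i \<noteq> l \<longrightarrow> C $$ (i, i) = A $$ (i, i))"
    proof cases
      case 1
      then show ?thesis using clear less.prems by blast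
    next
      case 2
      let ?C = "add_col_sub_row (- A $$ (k, k) / A $$ (k, l)) l k A"
      have "?C $$ (k, k) = 0" "\<forall>i<n. i \<noteq> k \<longrightarrow> i \<noteq> l \<longrightarrow> ?C $$ (i, i) = A $$ (i, i)"
        using less.prems(1) 2 k l kl by simp_all
      then show ?thesis
        using add_col_sub_row_similar[OF less.prems(1) l(1) k(1) kl[symmetric]]
          add_col_sub_row_carrier(3)[OF less.prems(1)] by blast
    next
      case 3
      \<comment> \<open>When both off-diagonal entries vanish, this puts
        \<open>A $$ (l, l) - A $$ (k, k)\<close> at position \<open>(l, k)\<close>. It is nonzero by
        the choice of \<open>l\<close>, so \<open>clear\<close> applies.\<close>
      let ?M = "add_col_sub_row 1 l k A"
      have M: "similar_mat ?M A" "?M \<in> carrier_mat n n"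
        using add_col_sub_row_similar[OF less.prems(1) l(1) k(1) kl[symmetric]]
          add_col_sub_row_carrier(3)[OF less.prems(1)] by blast+
      have "?M $$ (l, k) \<noteq> 0" and keep: "\<forall>i<n. i \<noteq> k \<longrightarrow> i \<noteq> l \<longrightarrow> ?M $$ (i, i) = A $$ (i, i)"
        using 3 less.prems(1) k l kl by simp_all
      then obtain C where "similar_mat C ?M" "C \<in> carrier_mat n n" "C $$ (k, k) = 0"
          "\<forall>i<n. i \<noteq> k \<longrightarrow> i \<noteq> l \<longrightarrow> C $$ (i, i) = ?M $$ (i, i)"
        using clear[OF M(2)] by blast
      then show ?thesis using M(1) keep by (metis similar_mat_trans)
    qed
    then show ?thesis using reduce[OF k l(1,2) kl] by blast
  qed
qed

section \<open>Conjugations that enlarge the support\<close>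

definition supp :: "nat \<Rightarrow> 'a :: zero mat \<Rightarrow> (nat \<times> nat) set" where
  "supp n Z = {(i, j). i < n \<and> j < n \<and> Z $$ (i, j) \<noteq> 0}"

definition grows :: "nat \<Rightarrow> 'a :: semiring_1 mat \<Rightarrow> 'a mat \<Rightarrow> bool" where
  "grows n Z Z' \<longleftrightarrow> similar_mat Z' Z \<and> hollow n Z' \<and> supp n Z \<subseteq> supp n Z'"

lemma growsD:
  assumes "grows n Z Z'"
  shows "similar_mat Z' Z" "hollow n Z'"
    "\<And>i j. i < n \<Longrightarrow> j < n \<Longrightarrow> Z $$ (i, j) \<noteq> 0 \<Longrightarrow> Z' $$ (i, j) \<noteq> 0"
  using assms unfolding grows_def supp_def by auto

lemma grows_trans: "grows n X Y \<Longrightarrow> grows n Y Z \<Longrightarrow> grows n X Z"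
  unfolding grows_def using similar_mat_trans by blast

lemma hollow_transvection:
  assumes "hollow n Z" "k < n" "l < n" "k \<noteq> l" "Z $$ (l, k) = 0"
  shows "hollow n (add_col_sub_row a k l Z)"
  using assms unfolding hollow_def by auto

text \<open>The entries of row \<open>k\<close> and column \<open>l\<close>, away from their
  crossing, become polynomials of degree at most 1 in the parameter. A generic value merges the
  support of row \<open>l\<close> into row \<open>k\<close> and that of column \<open>k\<close> into
  column \<open>l\<close>. The crossing entry \<open>(k, l)\<close> is only corrected by terms in
  \<open>Z $$ (l, k)\<close> and the diagonal, all zero.\<close>

lemma grows_transvection:
  fixes Z :: "'a :: field_char_0 mat"
  assumes Z: "hollow n Z" and kl: "k < n" "l < n" "k \<noteq> l" and lk: "Z $$ (l, k) = 0"
  shows "\<exists>Z'. grows n Z Z'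
    \<and> (\<forall>j<n. j \<noteq> l \<longrightarrow> Z $$ (l, j) \<noteq> 0 \<longrightarrow> Z' $$ (k, j) \<noteq> 0)
    \<and> (\<forall>i<n. i \<noteq> k \<longrightarrow> Z $$ (i, k) \<noteq> 0 \<longrightarrow> Z' $$ (i, l) \<noteq> 0)
    \<and> Z' $$ (k, l) = Z $$ (k, l)"
proof -
  define S where "S = (\<lambda>j. [:Z $$ (k, j), - Z $$ (l, j):]) ` {..<n} \<union> (\<lambda>i. [:Z $$ (i, l), Z $$ (i, k):]) ` {..<n}"
  have "finite S" unfolding S_def by auto
  then obtain a where a: "\<forall>p\<in>S - {0}. poly p a \<noteq> 0" using generic_nonroot by blast
  have row: "Z $$ (k, j) - a * Z $$ (l, j) \<noteq> 0" if "j < n" "Z $$ (k, j) \<noteq> 0 \<or> Z $$ (l, j) \<noteq> 0" for j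
    using a[rule_format, of "[:Z $$ (k, j), - Z $$ (l, j):]"] that unfolding S_def by auto
  have col: "Z $$ (i, l) + a * Z $$ (i, k) \<noteq> 0" if "i < n" "Z $$ (i, l) \<noteq> 0 \<or> Z $$ (i, k) \<noteq> 0" for i
    using a[rule_format, of "[:Z $$ (i, l), Z $$ (i, k):]"] that unfolding S_def by auto
  let ?Z = "add_col_sub_row a k l Z"
  have c: "Z \<in> carrier_mat n n" and d: "dim_row Z = n" "dim_col Z = n" "\<And>i. i < n \<Longrightarrow> Z $$ (i, i) = 0"
    using Z unfolding hollow_def by auto
  have "similar_mat ?Z Z" using c kl by (rule add_col_sub_row_similar)
  moreover have "hollow n ?Z" using hollow_transvection assms by blast
  moreover have "supp n Z \<subseteq> supp n ?Z"
    unfolding supp_def using d kl lk row col by (auto split: if_splits)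
  ultimately have "grows n Z ?Z" unfolding grows_def by blast
  moreover have "\<forall>j<n. j \<noteq> l \<longrightarrow> Z $$ (l, j) \<noteq> 0 \<longrightarrow> ?Z $$ (k, j) \<noteq> 0"
    "\<forall>i<n. i \<noteq> k \<longrightarrow> Z $$ (i, k) \<noteq> 0 \<longrightarrow> ?Z $$ (i, l) \<noteq> 0"
    "?Z $$ (k, l) = Z $$ (k, l)"
    using d kl lk row col by simp_all
  ultimately show ?thesis by blast
qed

text \<open>The block on rows and columns \<open>p, q\<close> has the form \<open>M = [[0, \<alpha>], [\<beta>, 0]]\<close>. Conjugation by
  \<open>1 + (y / \<alpha>) M\<close> on these two coordinates fixes \<open>M\<close>, hence the zero diagonal. Up to a diagonal factor,
  this is the product of two transvections.\<close>

lemma grows_rotation: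
  fixes Z :: "'a :: field_char_0 mat"
  assumes Z: "hollow n Z" and pq: "p < n" "q < n" "p \<noteq> q"
    and nz: "Z $$ (p, q) \<noteq> 0" "Z $$ (q, p) \<noteq> 0"
  shows "\<exists>Z'. grows n Z Z'
    \<and> (\<forall>k<n. k \<noteq> p \<longrightarrow> k \<noteq> q \<longrightarrow> Z $$ (q, k) \<noteq> 0 \<longrightarrow> Z' $$ (p, k) \<noteq> 0)
    \<and> (\<forall>k<n. k \<noteq> p \<longrightarrow> k \<noteq> q \<longrightarrow> Z $$ (k, q) \<noteq> 0 \<longrightarrow> Z' $$ (k, p) \<noteq> 0)"
proof -
  define \<alpha> \<beta> where "\<alpha> = Z $$ (p, q)" and "\<beta> = Z $$ (q, p)"
  have ab: "\<alpha> \<noteq> 0" "\<beta> \<noteq> 0" using nz \<alpha>_def \<beta>_def by auto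
  \<comment> \<open>The polynomials stand for \<delta> and the new entries of row \<open>p\<close>,
    row \<open>q\<close>, column \<open>q\<close> and column \<open>p\<close>, in this order; those
    of row \<open>q\<close> and column \<open>p\<close> are multiplied by \<delta> to clear the
    denominator of \<open>x\<close>.\<close>
  define S where "S = {[:\<alpha>, 0, - \<beta>:]}
    \<union> (\<lambda>k. [:Z $$ (p, k), - Z $$ (q, k):]) ` {..<n}
    \<union> (\<lambda>k. [:\<alpha> * Z $$ (q, k), - \<beta> * Z $$ (p, k):]) ` {..<n}
    \<union> (\<lambda>k. [:Z $$ (k, q), Z $$ (k, p):]) ` {..<n}
    \<union> (\<lambda>k. [:\<alpha> * Z $$ (k, p), \<beta> * Z $$ (k, q):]) ` {..<n}"
  have "finite S" unfolding S_def by auto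
  then obtain y where y: "\<forall>f\<in>S - {0}. poly f y \<noteq> 0" using generic_nonroot by blast
  define \<delta> where "\<delta> = \<alpha> - y * y * \<beta>"
  have \<delta>: "\<delta> \<noteq> 0"
    using y[rule_format, of "[:\<alpha>, 0, - \<beta>:]"] ab unfolding S_def \<delta>_def by (auto simp: algebra_simps)
  have g1: "Z $$ (p, k) - y * Z $$ (q, k) \<noteq> 0" if "k < n" "Z $$ (p, k) \<noteq> 0 \<or> Z $$ (q, k) \<noteq> 0" for k
    using y[rule_format, of "[:Z $$ (p, k), - Z $$ (q, k):]"] that unfolding S_def by auto
  have g2: "\<alpha> * Z $$ (q, k) - y * \<beta> * Z $$ (p, k) \<noteq> 0" if "k < n" "Z $$ (q, k) \<noteq> 0" for k
    using y[rule_format, of "[:\<alpha> * Z $$ (q, k), - \<beta> * Z $$ (p, k):]"] that ab unfolding S_def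
    by (auto simp: algebra_simps)
  have g3: "Z $$ (k, q) + y * Z $$ (k, p) \<noteq> 0" if "k < n" "Z $$ (k, q) \<noteq> 0" for k
    using y[rule_format, of "[:Z $$ (k, q), Z $$ (k, p):]"] that unfolding S_def by auto
  have g4: "\<alpha> * Z $$ (k, p) + y * \<beta> * Z $$ (k, q) \<noteq> 0" if "k < n" "Z $$ (k, p) \<noteq> 0 \<or> Z $$ (k, q) \<noteq> 0" for k
    using y[rule_format, of "[:\<alpha> * Z $$ (k, p), \<beta> * Z $$ (k, q):]"] that ab unfolding S_def
    by (auto simp: algebra_simps)
  \<comment> \<open>After the first transvection the diagonal has \<open>- y * \<beta>\<close> at
    \<open>p\<close> and \<open>y * \<beta>\<close> at \<open>q\<close>, with \<delta> at
    \<open>(p, q)\<close>. The second one shifts these by \<open>x * \<delta>\<close> with opposite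
    signs, so this \<open>x\<close> cancels both.\<close>
  define x where "x = y * \<beta> / \<delta>"
  have x\<delta>: "x * \<delta> = y * \<beta>" using \<delta> by (simp add: x_def)
  let ?Y = "add_col_sub_row y p q Z"
  let ?Z = "add_col_sub_row x q p ?Y"
  have c: "Z \<in> carrier_mat n n" and d: "dim_row Z = n" "dim_col Z = n" "\<And>i. i < n \<Longrightarrow> Z $$ (i, i) = 0"
    using Z unfolding hollow_def by auto
  have cY: "?Y \<in> carrier_mat n n" and cZ: "?Z \<in> carrier_mat n n" using c by auto
  have sim: "similar_mat ?Z Z"
    using similar_mat_trans[OF add_col_sub_row_similar[OF cY] add_col_sub_row_similar[OF c]] pq by metis
  have diag: "?Z $$ (k, k) = 0" if "k < n" for k
    using that d pq x\<delta> unfolding \<delta>_def \<alpha>_def \<beta>_def by (auto simp: algebra_simps)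
  have Zpq: "?Z $$ (p, q) = \<delta>"
    using d pq unfolding \<delta>_def \<alpha>_def \<beta>_def by auto
  \<comment> \<open>This is invariance of the determinant of the block on \<open>p\<close>,
    \<open>q\<close>, whose diagonal is again zero.\<close>
  have Zqp: "\<delta> * ?Z $$ (q, p) = \<alpha> * \<beta>"
  proof -
    have "?Z $$ (q, p) = \<beta> + x * y * \<beta> - x * (x * \<delta>) + x * y * \<beta>"
      using d pq unfolding \<delta>_def \<alpha>_def \<beta>_def by (simp add: algebra_simps)
    then have "?Z $$ (q, p) = \<beta> + x * y * \<beta>"
      unfolding x\<delta> by (simp add: algebra_simps)
    then have "\<delta> * ?Z $$ (q, p) = \<delta> * \<beta> + (x * \<delta>) * y * \<beta>"
      by (simp add: algebra_simps)
    then show ?thesis unfolding x\<delta> unfolding \<delta>_def by (simp add: algebra_simps)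
  qed
  have Zpk: "?Z $$ (p, k) = Z $$ (p, k) - y * Z $$ (q, k)"
    and Zkq: "?Z $$ (k, q) = Z $$ (k, q) + y * Z $$ (k, p)" if "k < n" "k \<noteq> p" "k \<noteq> q" for k
    using that d pq by auto
  have Zqk: "\<delta> * ?Z $$ (q, k) = \<alpha> * Z $$ (q, k) - y * \<beta> * Z $$ (p, k)" if "k < n" "k \<noteq> p" "k \<noteq> q" for k
  proof -
    have "\<delta> * ?Z $$ (q, k) = \<delta> * Z $$ (q, k) - (x * \<delta>) * (Z $$ (p, k) - y * Z $$ (q, k))"
      using that d pq by (auto simp: algebra_simps)
    then show ?thesis unfolding x\<delta> unfolding \<delta>_def by (simp add: algebra_simps)
  qed
  have Zkp: "\<delta> * ?Z $$ (k, p) = \<alpha> * Z $$ (k, p) + y * \<beta> * Z $$ (k, q)" if "k < n" "k \<noteq> p" "k \<noteq> q" for k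
  proof -
    have "\<delta> * ?Z $$ (k, p) = \<delta> * Z $$ (k, p) + (x * \<delta>) * (Z $$ (k, q) + y * Z $$ (k, p))"
      using that d pq by (auto simp: algebra_simps)
    then show ?thesis unfolding x\<delta> unfolding \<delta>_def by (simp add: algebra_simps)
  qed
  have Zother: "?Z $$ (i, j) = Z $$ (i, j)" if "i < n" "j < n" "i \<noteq> p" "i \<noteq> q" "j \<noteq> p" "j \<noteq> q" for i j
    using that d pq by auto
  have keep: "?Z $$ (i, j) \<noteq> 0" if ij: "i < n" "j < n" "Z $$ (i, j) \<noteq> 0" for i j
  proof -
    have "i \<noteq> j" using ij d by auto
    then consider "i = p" "j = q" | "i = q" "j = p" | "i = p" "j \<noteq> p" "j \<noteq> q" | "i = q" "j \<noteq> p" "j \<noteq> q"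
      | "j = p" "i \<noteq> p" "i \<noteq> q" | "j = q" "i \<noteq> p" "i \<noteq> q" | "i \<noteq> p" "i \<noteq> q" "j \<noteq> p" "j \<noteq> q"
      by blast
    then show ?thesis
    proof cases
      case 1 then show ?thesis using Zpq \<delta> by simp
    next
      case 2 then show ?thesis using Zqp ab by (metis mult_eq_0_iff)
    next
      case 3 then show ?thesis using Zpk[of j] g1[of j] ij by simp
    next
      case 4 then show ?thesis using Zqk[of j] g2[of j] ij by (metis mult_zero_right)
    next
      case 5 then show ?thesis using Zkp[of i] g4[of i] ij by (metis mult_zero_right)
    next
      case 6 then show ?thesis using Zkq[of i] g3[of i] ij by simp
    next
      case 7 then show ?thesis using Zother ij by simp
    qed
  qed
  have "grows n Z ?Z"
    using sim diag cZ keep unfolding grows_def hollow_def supp_def by blast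
  moreover have "?Z $$ (p, k) \<noteq> 0" if "k < n" "k \<noteq> p" "k \<noteq> q" "Z $$ (q, k) \<noteq> 0" for k
    using that g1[of k] Zpk[of k] by simp
  moreover have "?Z $$ (k, p) \<noteq> 0" if "k < n" "k \<noteq> p" "k \<noteq> q" "Z $$ (k, q) \<noteq> 0" for k
    using that g4[of k] Zkp[of k] by (metis mult_zero_right)
  ultimately show ?thesis by blast
qed

section \<open>Matrices of maximal support\<close>

definition saturated :: "nat \<Rightarrow> 'a :: semiring_1 mat \<Rightarrow> bool" where
  "saturated n Z \<longleftrightarrow> hollow n Z \<and> (\<forall>Z'. grows n Z Z' \<longrightarrow> supp n Z' \<subseteq> supp n Z)"

text \<open>Supports have at most \<open>n * n\<close> elements, so some growth of \<open>Z\<close>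
  has a largest support. By transitivity, growing it further cannot add to its support.\<close>

lemma saturate:
  assumes "hollow n Z"
  shows "\<exists>Z'. grows n Z Z' \<and> saturated n Z'"
proof -
  have fin: "finite (supp n Y)" and bd: "card (supp n Y) \<le> n * n" for Y :: "'a mat"
  proof -
    have "supp n Y \<subseteq> {..<n} \<times> {..<n}" unfolding supp_def by auto
    then show "finite (supp n Y)" "card (supp n Y) \<le> n * n"
      using finite_subset card_mono[of "{..<n} \<times> {..<n}" "supp n Y"] by auto
  qed
  have "grows n Z Z" using assms similar_mat_refl unfolding grows_def hollow_def by blast
  then obtain Y where Y: "grows n Z Y" "\<And>X. grows n Z X \<Longrightarrow> card (supp n X) \<le> card (supp n Y)"
    using ex_has_greatest_nat[of "grows n Z" Z "\<lambda>X. card (supp n X)" "n * n + 1"] bd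
    by (metis less_add_one order_le_less_trans)
  have "supp n X \<subseteq> supp n Y" if X: "grows n Y X" for X
  proof -
    have "supp n Y \<subseteq> supp n X" using X unfolding grows_def by simp
    then have "supp n Y = supp n X"
      using Y(2)[OF grows_trans[OF Y(1) X]] card_seteq[OF fin] by blast
    then show ?thesis by simp
  qed
  then show ?thesis using Y(1) growsD(2) unfolding saturated_def by blast
qed

lemma saturatedD:
  assumes "saturated n Z" "grows n Z Z'" "i < n" "j < n" "Z' $$ (i, j) \<noteq> 0"
  shows "Z $$ (i, j) \<noteq> 0"
  using assms unfolding saturated_def supp_def by blast

text \<open>An entry that a generic transvection would make nonzero must, by maximality, be nonzero
  already.\<close>

lemma saturated_transvection:
  fixes Z :: "'a :: field_char_0 mat"
  assumes Z: "saturated n Z" and lt: "k < n" "l < n" "m < n" and ne: "k \<noteq> l" "m \<noteq> k" "m \<noteq> l"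
    and lk: "Z $$ (l, k) = 0"
  shows "Z $$ (l, m) \<noteq> 0 \<Longrightarrow> Z $$ (k, m) \<noteq> 0" "Z $$ (m, k) \<noteq> 0 \<Longrightarrow> Z $$ (m, l) \<noteq> 0"
proof -
  have "hollow n Z" using Z unfolding saturated_def by simp
  from grows_transvection[OF this lt(1,2) ne(1) lk] obtain Z' where Z': "grows n Z Z'"
    "\<forall>j<n. j \<noteq> l \<longrightarrow> Z $$ (l, j) \<noteq> 0 \<longrightarrow> Z' $$ (k, j) \<noteq> 0"
    "\<forall>i<n. i \<noteq> k \<longrightarrow> Z $$ (i, k) \<noteq> 0 \<longrightarrow> Z' $$ (i, l) \<noteq> 0" by blast
  show "Z $$ (l, m) \<noteq> 0 \<Longrightarrow> Z $$ (k, m) \<noteq> 0" "Z $$ (m, k) \<noteq> 0 \<Longrightarrow> Z $$ (m, l) \<noteq> 0"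
    using saturatedD[OF Z Z'(1)] Z'(2,3) lt ne by blast+
qed

lemma saturated_rotation:
  fixes Z :: "'a :: field_char_0 mat"
  assumes Z: "saturated n Z" and lt: "p < n" "q < n" "k < n" and ne: "p \<noteq> q" "k \<noteq> p" "k \<noteq> q"
    and nz: "Z $$ (p, q) \<noteq> 0" "Z $$ (q, p) \<noteq> 0"
  shows "Z $$ (q, k) \<noteq> 0 \<Longrightarrow> Z $$ (p, k) \<noteq> 0" "Z $$ (k, q) \<noteq> 0 \<Longrightarrow> Z $$ (k, p) \<noteq> 0"
proof -
  have "hollow n Z" using Z unfolding saturated_def by simp
  from grows_rotation[OF this lt(1,2) ne(1) nz] obtain Z' where Z': "grows n Z Z'"
    "\<forall>k<n. k \<noteq> p \<longrightarrow> k \<noteq> q \<longrightarrow> Z $$ (q, k) \<noteq> 0 \<longrightarrow> Z' $$ (p, k) \<noteq> 0"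
    "\<forall>k<n. k \<noteq> p \<longrightarrow> k \<noteq> q \<longrightarrow> Z $$ (k, q) \<noteq> 0 \<longrightarrow> Z' $$ (k, p) \<noteq> 0" by blast
  show "Z $$ (q, k) \<noteq> 0 \<Longrightarrow> Z $$ (p, k) \<noteq> 0" "Z $$ (k, q) \<noteq> 0 \<Longrightarrow> Z $$ (k, p) \<noteq> 0"
    using saturatedD[OF Z Z'(1)] Z'(2,3) lt ne by blast+
qed

section \<open>Growing a clique of nonzero entries\<close>

definition clique :: "nat \<Rightarrow> 'a :: zero mat \<Rightarrow> nat set \<Rightarrow> bool" where
  "clique n Z K \<longleftrightarrow> K \<subseteq> {..<n} \<and> (\<forall>i\<in>K. \<forall>j\<in>K. i \<noteq> j \<longrightarrow> Z $$ (i, j) \<noteq> 0)"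

lemma cliqueD: "clique n Z K \<Longrightarrow> i \<in> K \<Longrightarrow> i < n"
  "clique n Z K \<Longrightarrow> i \<in> K \<Longrightarrow> j \<in> K \<Longrightarrow> i \<noteq> j \<Longrightarrow> Z $$ (i, j) \<noteq> 0"
  unfolding clique_def by auto

lemma clique_grows: "clique n Z K \<Longrightarrow> grows n Z Z' \<Longrightarrow> clique n Z' K"
  unfolding clique_def using growsD(3) by blast

text \<open>For any other \<open>l\<close> in \<open>K\<close>, the entries at \<open>(l, p)\<close>
  and \<open>(p, l)\<close> are both nonzero, so rotating these two coordinates carries the links
  between \<open>p\<close> and \<open>k\<close> over to \<open>l\<close>.\<close>

lemma saturated_clique_insert:
  fixes Z :: "'a :: field_char_0 mat"
  assumes Z: "saturated n Z" and K: "clique n Z K" and p: "p \<in> K" and k: "k < n" "k \<notin> K"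
    and nz: "Z $$ (p, k) \<noteq> 0" "Z $$ (k, p) \<noteq> 0"
  shows "clique n Z (insert k K)"
proof -
  have "Z $$ (l, k) \<noteq> 0 \<and> Z $$ (k, l) \<noteq> 0" if l: "l \<in> K" for l
  proof (cases "l = p")
    case False
    then show ?thesis
      using saturated_rotation[OF Z, of l p k] cliqueD[OF K] p l k nz by metis
  qed (use nz in simp)
  then show ?thesis using K k unfolding clique_def by auto
qed

text \<open>Two transvections between \<open>q\<close> and \<open>k\<close> transport the opposite nonzero entries at \<open>(p, q)\<close> and
  \<open>(q, p)\<close> to \<open>(p, k)\<close> and \<open>(k, p)\<close>. The two zeros in the hypothesis keep the diagonal zero.\<close>

lemma clique_insert_disconnected:
  fixes Z :: "'a :: field_char_0 mat"
  assumes Z: "hollow n Z" and K: "clique n Z K" and pq: "p \<in> K" "q \<in> K" "p \<noteq> q"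
    and k: "k < n" "k \<notin> K" and z: "Z $$ (k, q) = 0" "Z $$ (q, k) = 0"
  shows "\<exists>Z'. similar_mat Z' Z \<and> hollow n Z' \<and> clique n Z' (insert k K)"
proof -
  have lt: "p < n" "q < n" and ne: "k \<noteq> p" "k \<noteq> q" "p \<noteq> k" "q \<noteq> k"
    using cliqueD[OF K] pq k by auto
  note c = cliqueD(2)[OF K]
  obtain X where X: "grows n Z X" "X $$ (q, k) = 0" "X $$ (p, k) \<noteq> 0"
    using grows_transvection[OF Z lt(2) k(1) ne(4) z(1)] c[OF pq] z lt pq by metis
  have "X $$ (q, p) \<noteq> 0" using growsD(3)[OF X(1) lt(2,1)] c pq by blast
  then obtain Y where Y: "grows n X Y" "Y $$ (k, p) \<noteq> 0"
    using grows_transvection[OF growsD(2)[OF X(1)] k(1) lt(2) ne(2) X(2)] lt pq by metis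
  \<comment> \<open>Saturating spreads the two-way link between \<open>p\<close> and
    \<open>k\<close> to all of \<open>K\<close>.\<close>
  obtain W where W: "grows n Y W" "saturated n W" using saturate growsD(2)[OF Y(1)] by blast
  have ZW: "grows n Z W" using grows_trans X(1) Y(1) W(1) by blast
  have "W $$ (p, k) \<noteq> 0" "W $$ (k, p) \<noteq> 0"
    using growsD(3)[OF W(1)] growsD(3)[OF Y(1)] X Y lt k by blast+
  then have "clique n W (insert k K)"
    using saturated_clique_insert[OF W(2) clique_grows[OF K ZW] pq(1) k] by blast
  then show ?thesis using growsD[OF ZW] by blast
qed

text \<open>If \<open>k\<close> is joined to the clique in at most one direction, subtracting a multiple of row or column
  \<open>p\<close> from that of \<open>k\<close> cuts its last link to \<open>q\<close> without touching the clique.\<close>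

lemma clique_insert:
  fixes Z :: "'a :: field_char_0 mat"
  assumes Z: "hollow n Z" and K: "clique n Z K" and pq: "p \<in> K" "q \<in> K" "p \<noteq> q"
    and k: "k < n" "k \<notin> K"
  shows "\<exists>Z'. similar_mat Z' Z \<and> hollow n Z' \<and> clique n Z' (insert k K)"
proof -
  obtain X where X: "grows n Z X" "saturated n X" using saturate[OF Z] by blast
  have KX: "clique n X K" using clique_grows[OF K X(1)] .
  have hX: "hollow n X" using growsD(2)[OF X(1)] .
  have lt: "p < n" "q < n" and ne: "k \<noteq> p" "k \<noteq> q" "p \<noteq> k" "q \<noteq> k"
    using cliqueD[OF K] pq k by auto
  have cX: "X \<in> carrier_mat n n" and d: "dim_row X = n" "dim_col X = n"
    using hX unfolding hollow_def by auto
  \<comment> \<open>Cutting links destroys nonzero entries, so \<open>Y\<close> need not be a growth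
    of \<open>X\<close>; similarity and the clique are what survives.\<close>
  have finish: ?thesis if "similar_mat Y X" "hollow n Y" "clique n Y K" "Y $$ (k, q) = 0" "Y $$ (q, k) = 0" for Y
    using clique_insert_disconnected[OF that(2,3) pq k that(4,5)] that(1) growsD(1)[OF X(1)]
      similar_mat_trans by blast
  consider "X $$ (p, k) \<noteq> 0" "X $$ (k, p) \<noteq> 0" | "X $$ (k, p) = 0" | "X $$ (p, k) = 0" by blast
  then show ?thesis
  proof cases
    case 1
    then have "clique n X (insert k K)" by (rule saturated_clique_insert[OF X(2) KX pq(1) k])
    then show ?thesis using growsD[OF X(1)] by blast
  next
    case 2
    \<comment> \<open>All of row \<open>k\<close> vanishes on \<open>K\<close>: a nonzero entry at
      \<open>(k, l)\<close> would be carried to \<open>(k, p)\<close> by a rotation.\<close>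
    have z: "X $$ (k, l) = 0" if l: "l \<in> K" for l
      using saturated_rotation(2)[OF X(2), of p l k] cliqueD[OF KX] pq(1) l k 2 by metis
    let ?Y = "add_col_sub_row (- X $$ (q, k) / X $$ (q, p)) p k X"
    have "similar_mat ?Y X" using cX lt(1) k(1) ne(3) by (rule add_col_sub_row_similar)
    moreover have "hollow n ?Y" by (rule hollow_transvection[OF hX lt(1) k(1) ne(3) 2])
    \<comment> \<open>Row \<open>p\<close> changes by a multiple of row \<open>k\<close>, which is
      zero on \<open>K\<close>, and the altered column \<open>k\<close> lies outside
      \<open>K\<close>.\<close>
    moreover have "?Y $$ (i, j) = X $$ (i, j)" if "i \<in> K" "j \<in> K" for i j
      using that z cliqueD(1)[OF K] d lt k ne by auto
    then have "clique n ?Y K" using KX unfolding clique_def by simp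
    moreover have "?Y $$ (k, q) = 0" using d lt k ne pq z by auto
    moreover have "?Y $$ (q, k) = 0" using d lt k ne pq cliqueD(2)[OF KX, of q p] by auto
    ultimately show ?thesis by (rule finish)
  next
    case 3
    \<comment> \<open>Mirror image of the previous case, with column \<open>k\<close> vanishing on
      \<open>K\<close>.\<close>
    have z: "X $$ (l, k) = 0" if l: "l \<in> K" for l
      using saturated_rotation(1)[OF X(2), of p l k] cliqueD[OF KX] pq(1) l k 3 by metis
    let ?Y = "add_col_sub_row (X $$ (k, q) / X $$ (p, q)) k p X"
    have "similar_mat ?Y X" using cX k(1) lt(1) ne(1) by (rule add_col_sub_row_similar)
    moreover have "hollow n ?Y" by (rule hollow_transvection[OF hX k(1) lt(1) ne(1) 3])
    moreover have "?Y $$ (i, j) = X $$ (i, j)" if "i \<in> K" "j \<in> K" for i j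
      using that z cliqueD(1)[OF K] d lt k ne by auto
    then have "clique n ?Y K" using KX unfolding clique_def by simp
    moreover have "?Y $$ (k, q) = 0" using d lt k ne pq cliqueD(2)[OF KX, of p q] by auto
    moreover have "?Y $$ (q, k) = 0" using d lt k ne pq z by auto
    ultimately show ?thesis by (rule finish)
  qed
qed

lemma clique_full:
  fixes Z :: "'a :: field_char_0 mat"
  assumes "hollow n Z" "clique n Z K" "p \<in> K" "q \<in> K" "p \<noteq> q"
  shows "\<exists>Z'. similar_mat Z' Z \<and> hollow n Z' \<and> clique n Z' {..<n}"
  using assms
proof (induction "card ({..<n} - K)" arbitrary: Z K rule: less_induct)
  case less
  have sub: "K \<subseteq> {..<n}" using less.prems(2) unfolding clique_def by simp
  show ?case
  proof (cases "K = {..<n}")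
    case True
    then show ?thesis using less.prems similar_mat_refl unfolding hollow_def by blast
  next
    case False
    then obtain k where k: "k < n" "k \<notin> K" using sub by auto
    obtain Y where Y: "similar_mat Y Z" "hollow n Y" "clique n Y (insert k K)"
      using clique_insert[OF less.prems k] by blast
    have "card ({..<n} - insert k K) < card ({..<n} - K)"
      using k by (intro psubset_card_mono) auto
    then show ?thesis
      using less.hyps[OF _ Y(2,3)] less.prems Y(1) similar_mat_trans by blast
  qed
qed

section \<open>Splitting into two nilpotent summands\<close>

text \<open>By transitivity and irreflexivity, the number of predecessors strictly increases along
  \<open>E\<close>. Sorting by this number, with ties broken by the index itself, gives a strict
  linear order, and \<open>pos\<close> is the rank in it.\<close>

lemma topological_numbering:
  fixes E :: "nat \<Rightarrow> nat \<Rightarrow> bool"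
  assumes irr: "\<And>i. i < n \<Longrightarrow> \<not> E i i"
    and tr: "\<And>i j k. i < n \<Longrightarrow> j < n \<Longrightarrow> k < n \<Longrightarrow> E i j \<Longrightarrow> E j k \<Longrightarrow> E i k"
  shows "\<exists>pos. bij_betw pos {..<n} {..<n} \<and> (\<forall>i<n. \<forall>j<n. E i j \<longrightarrow> pos i < (pos j :: nat))"
proof -
  define f where "f i = card {l. l < n \<and> E l i}" for i
  define before where "before j = {i. i < n \<and> (f i < f j \<or> f i = f j \<and> i < j)}" for j
  define pos where "pos j = card (before j)" for j
  have f: "f i < f j" if "i < n" "j < n" "E i j" for i j
    unfolding f_def
  proof (rule psubset_card_mono)
    have "l < n \<and> E l j" if "l < n \<and> E l i" for l
      using that tr[of l i j] \<open>i < n\<close> \<open>j < n\<close> \<open>E i j\<close> by blast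
    then show "{l. l < n \<and> E l i} \<subset> {l. l < n \<and> E l j}"
      using irr[of i] that by blast
  qed simp
  have less: "pos i < pos j" if "i \<in> before j" for i j
    unfolding pos_def by (rule psubset_card_mono) (use that in \<open>auto simp: before_def\<close>)
  have total: "i \<in> before j \<or> j \<in> before i" if "i < n" "j < n" "i \<noteq> j" for i j
    using that unfolding before_def by auto
  have "inj_on pos {..<n}"
    using total less by (intro inj_onI) (metis lessThan_iff less_irrefl)
  moreover have "pos ` {..<n} \<subseteq> {..<n}"
  proof -
    have "pos j < card {..<n}" if "j < n" for j
      unfolding pos_def by (rule psubset_card_mono) (use that in \<open>auto simp: before_def\<close>)
    then show ?thesis by auto
  qed
  ultimately have "bij_betw pos {..<n} {..<n}"
    by (simp add: bij_betw_def endo_inj_surj)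
  moreover have "pos i < pos j" if "i < n" "j < n" "E i j" for i j
    using f[OF that] that less[of i j] unfolding before_def by auto
  ultimately show ?thesis by blast
qed

lemma ordered_decomposition:
  fixes Z :: "'a :: field_char_0 mat"
  assumes Z: "Z \<in> carrier_mat n n" and n: "n \<ge> 1" and pos: "bij_betw pos {..<n} {..<n}"
    and up: "\<And>i j. i < n \<Longrightarrow> j < n \<Longrightarrow> Z $$ (i, j) \<noteq> 0 \<Longrightarrow> pos i < pos j"
  shows "\<exists>B C. B \<in> carrier_mat n n \<and> C \<in> carrier_mat n n \<and>
    strictly_zero n B \<and> strictly_zero n C \<and> Z = B + C"
proof -
  \<comment> \<open>At consecutive positions a nonzero entry \<open>z\<close> splits as
    \<open>2 * z\<close> plus \<open>- z\<close> and a zero entry as \<open>1\<close> plus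
    \<open>- 1\<close>, so both summands are nonzero there. All other entries go to
    \<open>C\<close>.\<close>
  define g where "g i j = (if pos j = Suc (pos i) then if Z $$ (i, j) = 0 then 1 else 2 * Z $$ (i, j) else 0)" for i j
  define B where "B = mat n n (\<lambda>(i, j). g i j)"
  define C where "C = mat n n (\<lambda>(i, j). Z $$ (i, j) - g i j)"
  have "strictly_zero n B"
    by (rule strictly_zero_ordered[OF _ n pos]) (auto simp: B_def g_def split: if_splits)
  moreover have "strictly_zero n C"
    by (rule strictly_zero_ordered[OF _ n pos]) (use up in \<open>auto simp: C_def g_def split: if_splits\<close>)
  moreover have "Z = B + C" using Z unfolding B_def C_def by (intro eq_matI) auto
  ultimately show ?thesis unfolding B_def C_def by (meson mat_carrier)
qed

lemma full_decomposition:
  fixes Z :: "'a :: field_char_0 mat"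
  assumes Z: "hollow n Z" and n: "n \<ge> 1" and full: "clique n Z {..<n}"
  shows "\<exists>B C. B \<in> carrier_mat n n \<and> C \<in> carrier_mat n n \<and>
    strictly_zero n B \<and> strictly_zero n C \<and> Z = B + C"
proof -
  define B where "B = mat n n (\<lambda>(i, j). if i < j then Z $$ (i, j) else 0)"
  define C where "C = mat n n (\<lambda>(i, j). if j < i then Z $$ (i, j) else 0)"
  have nz: "Z $$ (i, j) \<noteq> 0" if "i < n" "j < n" "i \<noteq> j" for i j
    using cliqueD(2)[OF full] that by simp
  have id: "bij_betw (\<lambda>i. i) {..<n} {..<n}" by (auto simp: bij_betw_def)
  \<comment> \<open>Reversing the indices makes the strictly lower triangular part increasing, so
    the same criterion covers it.\<close>
  have rev: "bij_betw (\<lambda>i. n - Suc i) {..<n} {..<n}"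
    by (rule bij_betw_byWitness[where f' = "\<lambda>i. n - Suc i"]) auto
  have "strictly_zero n B"
    by (rule strictly_zero_ordered[OF _ n id]) (auto simp: B_def nz split: if_splits)
  moreover have "strictly_zero n C"
    by (rule strictly_zero_ordered[OF _ n rev]) (auto simp: C_def nz split: if_splits)
  moreover have "Z = B + C"
  proof (rule eq_matI)
    fix i j assume "i < dim_row (B + C)" "j < dim_col (B + C)"
    then show "Z $$ (i, j) = (B + C) $$ (i, j)"
      using Z unfolding B_def C_def hollow_def by (cases i j rule: linorder_cases) auto
  qed (use Z in \<open>auto simp: B_def C_def hollow_def\<close>)
  ultimately show ?thesis unfolding B_def C_def by (meson mat_carrier)
qed

lemma hollow_decomposition:
  fixes Z :: "'a :: field_char_0 mat"
  assumes Z: "hollow n Z" and n: "n \<ge> 1"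
  shows "\<exists>Y B C. similar_mat Y Z \<and> B \<in> carrier_mat n n \<and> C \<in> carrier_mat n n \<and>
    strictly_zero n B \<and> strictly_zero n C \<and> Y = B + C"
proof -
  obtain X where X: "grows n Z X" "saturated n X" using saturate[OF Z] by blast
  have h: "hollow n X" using growsD(2)[OF X(1)] .
  show ?thesis
  proof (cases "\<exists>p<n. \<exists>q<n. X $$ (p, q) \<noteq> 0 \<and> X $$ (q, p) \<noteq> 0")
    case True
    then obtain p q where pq: "p < n" "q < n" "X $$ (p, q) \<noteq> 0" "X $$ (q, p) \<noteq> 0" by blast
    then have "p \<noteq> q" "clique n X {p, q}" using h unfolding hollow_def clique_def by auto
    then obtain Y where Y: "similar_mat Y X" "hollow n Y" "clique n Y {..<n}"
      using clique_full[OF h] by blast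
    then have "similar_mat Y Z" using growsD(1)[OF X(1)] similar_mat_trans by blast
    then show ?thesis using full_decomposition[OF Y(2) n Y(3)] by blast
  next
    case False
    \<comment> \<open>With no opposite pair, a nonzero entry at \<open>(i, j)\<close> forces a zero
      at \<open>(j, i)\<close>. This permits the transvection that carries the entry at
      \<open>(j, k)\<close> to \<open>(i, k)\<close>.\<close>
    have trans: "X $$ (i, k) \<noteq> 0"
      if "i < n" "j < n" "k < n" "X $$ (i, j) \<noteq> 0" "X $$ (j, k) \<noteq> 0" for i j k
    proof -
      have "X $$ (j, i) = 0" "i \<noteq> j" "k \<noteq> i" "k \<noteq> j"
        using False that h unfolding hollow_def by auto
      then show ?thesis using saturated_transvection(1)[OF X(2), of i j k] that by blast
    qed
    obtain pos where pos: "bij_betw pos {..<n} {..<n}"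
      "\<forall>i<n. \<forall>j<n. X $$ (i, j) \<noteq> 0 \<longrightarrow> pos i < (pos j :: nat)"
      using topological_numbering[of n "\<lambda>i j. X $$ (i, j) \<noteq> 0"] trans h unfolding hollow_def by blast
    have "X \<in> carrier_mat n n" using h unfolding hollow_def by simp
    from ordered_decomposition[OF this n pos(1)] pos(2) show ?thesis
      using growsD(1)[OF X(1)] by blast
  qed
qed

theorem theorem4p6:
  fixes A :: "'a :: {alg_closed_field, field_char_0} mat" and n :: nat
  assumes "n \<ge> 1"
    and "A \<in> carrier_mat n n"
    and "mat_trace A = 0"
  shows "\<exists>B C. B \<in> carrier_mat n n \<and> C \<in> carrier_mat n n \<and>
           strictly_zero n B \<and> strictly_zero n C \<and> A = B + C"
proof -
  obtain Z where Z: "similar_mat Z A" "hollow n Z" using similar_hollow assms by blast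
  obtain Y B C where Y: "similar_mat Y Z" and BC: "B \<in> carrier_mat n n" "C \<in> carrier_mat n n"
      "strictly_zero n B" "strictly_zero n C" "Y = B + C"
    using hollow_decomposition[OF Z(2) assms(1)] by blast
  have "similar_mat A Y" using Y Z similar_mat_trans similar_mat_sym by blast
  then obtain P Q where wit: "similar_mat_wit A Y P Q" unfolding similar_mat_def by blast
  note w = similar_mat_witD2[OF assms(2) wit]
  \<comment> \<open>Conjugation by \<open>P\<close> and \<open>Q\<close> is additive and preserves
    the nilpotency index, so the splitting of \<open>Y\<close> transfers to \<open>A\<close> summand
    by summand.\<close>
  have conj: "strictly_zero n (P * M * Q)" if "M \<in> carrier_mat n n" "strictly_zero n M" for M
  proof (rule strictly_zero_similar)
    show "similar_mat_wit (P * M * Q) M P Q"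
      by (rule similar_mat_witI[of _ _ n]) (use w that in auto)
  qed (rule that(2))
  have "A = P * B * Q + P * C * Q"
    using w BC by (simp add: mult_add_distrib_mat[of _ n n] add_mult_distrib_mat[of _ n n])
  then show ?thesis using conj BC w
    by (intro exI[of _ "P * B * Q"] exI[of _ "P * C * Q"]) auto
qed

end
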